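(* If $(QP)$ is infeasible (i.e., $S = \emptyset$), then $(P(\mathcal{K}))$ is infeasible for any $\mathcal{K} \in \mathbb{K}$.
   Context: Quadratic program: let $Q \in \mathbb{R}^{n\times n}$ be symmetric, $c \in \mathbb{R}^n$, $A \in \mathbb{R}^{m \times n}$, $b \in \mathbb{R}^m$; put $q(x) = x^T Q x + 2c^T x$ and $S = \{x \in \mathbb{R}^n : Ax = b,\ x \ge 0\}$. $(QP)$ is the problem of minimizing $q(x)$ over $x \in S$. $\mathcal{S}^N$ denotes the real symmetric $N\times N$ matrices, and $\langle U,V\rangle = \sum_{i,j} U_{ij}V_{ij}$. Rows and columns of matrices in $\mathcal{S}^{n+1}$ are indexed by $0,1,\ldots,n$. $\mathcal{CP}^N = \{\sum_{j=1}^k y^j (y^j)^T : k \ge 1,\ y^j \in \mathbb{R}^N_+\}$ is the cone of completely positive matrices, and $\mathcal{P}^{n+1}$ is the cone of positive semidefinite $Y \in \mathcal{S}^{n+1}$ with $Y_{0j} \ge 0$ for $j = 1,\ldots,n$. $\mathbb{K}$ is the family of all closed convex cones $\mathcal{K} \subseteq \mathcal{S}^{n+1}$ with $\mathcal{CP}^{n+1} \subseteq \mathcal{K} \subseteq \mathcal{P}^{n+1}$. Let \[ \widehat{Q} = \begin{bmatrix} 0 & c^T \\ c & Q\end{bmatrix}, \qquad \widehat{A} = \begin{bmatrix} b^Tb & -b^TA \\ -A^Tb & A^TA\end{bmatrix}. \] $(P(\mathcal{K}))$: minimize $\langle \widehat{Q}, Y\rangle$ subject to $\langle \widehat{A}, Y\rangle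 = 0$, $Y_{00} = 1$, $Y \in \mathcal{K}$. It is infeasible if no $Y$ satisfies these constraints. *)

theory Defs
  imports "HOL-Analysis.Analysis"
begin

datatype 'a min_problem =
  Min_Problem (objective: "'a \<Rightarrow> real") (feasible_set: "'a set")

definition infeasible :: "'a min_problem \<Rightarrow> bool" where
  "infeasible P \<longleftrightarrow> feasible_set P = {}"

text \<open>The order on vectors in HOL-Analysis is componentwise, so \<open>0 \<le> x\<close> says \<open>x \<in> \<real>\<^sup>n\<^sub>+\<close>.\<close>

definition QP ::
    "real^'n^'n \<Rightarrow> real^'n \<Rightarrow> real^'n^'m \<Rightarrow> real^'m \<Rightarrow> (real^'n) min_problem" where
  "QP Q c A b =
     Min_Problem (\<lambda>x. x \<bullet> (Q *v x) + 2 * (c \<bullet> x)) {x. A *v x = b \<and> 0 \<le> x}"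

definition sym_mats :: "(real^'k^'k) set" where
  "sym_mats = {Y. transpose Y = Y}"

definition outer :: "real^'k \<Rightarrow> real^'k^'k" where
  "outer y = (\<chi> i j. y $ i * y $ j)"

definition CP :: "(real^'k^'k) set" where
  "CP = {Y. \<exists>(k::nat) y. k \<ge> 1 \<and> (\<forall>j\<in>{1..k}. 0 \<le> y j) \<and> Y = (\<Sum>j=1..k. outer (y j))}"

text \<open>
  The index set \<open>{0,1,\<dots>,n}\<close> of the matrices of order \<open>n + 1\<close> is the type \<open>'n option\<close>,
  where \<open>None\<close> is the index \<open>0\<close> and \<open>Some j\<close> is the index \<open>j\<close> of the original variables.
\<close>

definition psd0 :: "(real^('n::finite option)^('n option)) set" where
  "psd0 = {Y \<in> sym_mats. (\<forall>v. 0 \<le> v \<bullet> (Y *v v)) \<and> (\<forall>j. 0 \<le> Y $ None $ Some j)}"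

text \<open>
  As \<open>sym_mats\<close> is a closed subspace, closedness in it is closedness in the whole matrix space.
\<close>

definition cone_family :: "(real^('n::finite option)^('n option)) set set" where
  "cone_family = {K. K \<subseteq> sym_mats \<and> closed K \<and> convex_cone K \<and> CP \<subseteq> K \<and> K \<subseteq> psd0}"

definition block_mat ::
    "real \<Rightarrow> real^'n \<Rightarrow> real^'n \<Rightarrow> real^'n^'n \<Rightarrow> real^('n option)^('n option)" where
  "block_mat a r s M = (\<chi> i j.
     case i of
       None \<Rightarrow> (case j of None \<Rightarrow> a | Some l \<Rightarrow> r $ l)
     | Some k \<Rightarrow> (case j of None \<Rightarrow> s $ k | Some l \<Rightarrow> M $ k $ l))"

definition Q_hat :: "real^'n^'n \<Rightarrow> real^'n \<Rightarrow> real^('n option)^('n option)" where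
  "Q_hat Q c = block_mat 0 c c Q"

definition A_hat :: "real^'n^'m \<Rightarrow> real^'m \<Rightarrow> real^('n option)^('n option)" where
  "A_hat A b =
     block_mat (b \<bullet> b) (- (b v* A)) (- (transpose A *v b)) (transpose A ** A)"

text \<open>The library's inner product of matrices is the sum of the products of their entries.\<close>

definition conic_problem ::
    "real^'n^'n \<Rightarrow> real^'n \<Rightarrow> real^'n^'m \<Rightarrow> real^'m \<Rightarrow> (real^('n option)^('n option)) set
      \<Rightarrow> (real^('n option)^('n option)) min_problem" where
  "conic_problem Q c A b K =
     Min_Problem (\<lambda>Y. Q_hat Q c \<bullet> Y) {Y \<in> K. A_hat A b \<bullet> Y = 0 \<and> Y $ None $ None = 1}"

end

theory Submission
  imports Defs
begin

text \<open>
  With \<open>w\<^sub>i = (b\<^sub>i, - A\<^sub>i)\<close> built from the \<open>i\<close>-th row of \<open>A x = b\<close>, \<open>A_hat\<close> is the sum of the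
  \<open>w\<^sub>i w\<^sub>i\<^sup>T\<close>. For a feasible \<open>Y\<close> the nonnegative numbers \<open>w\<^sub>i\<^sup>T Y w\<^sub>i\<close> therefore add up to \<open>0\<close>,
  so each vanishes and \<open>Y w\<^sub>i = 0\<close> because \<open>Y\<close> is positive semidefinite. Component \<open>0\<close> of these
  equations says that \<open>x\<^sub>j = Y\<^sub>0\<^sub>j\<close> satisfies \<open>A x = b\<close>, and \<open>x \<ge> 0\<close> by the definition of \<open>psd0\<close>.
\<close>

definition row_vec :: "real^'n^'m \<Rightarrow> real^'m \<Rightarrow> 'm \<Rightarrow> real^('n option)" where
  "row_vec A b i = (\<chi> j. case j of None \<Rightarrow> b $ i | Some l \<Rightarrow> - A $ i $ l)"

lemma outer_inner: "outer y \<bullet> Y = y \<bullet> (Y *v y)"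
  by (simp add: outer_def inner_vec_def matrix_vector_mult_def sum_distrib_left mult_ac)

lemma A_hat_eq_sum_outer: "A_hat A b = (\<Sum>i\<in>UNIV. outer (row_vec A b i))"
  by (simp add: vec_eq_iff A_hat_def block_mat_def outer_def row_vec_def inner_vec_def
      vector_matrix_mult_def matrix_vector_mult_def matrix_matrix_mult_def transpose_def
      sum_negf mult_ac split: option.split)

lemma inner_matrix_vector_sym:
  fixes Y :: "real^'k^'k"
  assumes "Y \<in> sym_mats"
  shows "u \<bullet> (Y *v v) = v \<bullet> (Y *v u)"
  using assms by (metis (mono_tags) dot_lmul_matrix inner_commute mem_Collect_eq sym_mats_def
      transpose_matrix_vector)

text \<open>Along the line \<open>u + t *\<^sub>R v\<close> an isotropic \<open>v\<close> leaves the
  quadratic form affine in \<open>t\<close>, with slope \<open>2 * (u \<bullet> (Y *v v))\<close>;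
  being nonnegative for all \<open>t\<close> forces the slope to vanish.\<close>

lemma psd_isotropic_imp_kernel:
  fixes Y :: "real^'k^'k"
  assumes sym: "Y \<in> sym_mats" and psd: "\<And>v. 0 \<le> v \<bullet> (Y *v v)" and v: "v \<bullet> (Y *v v) = 0"
  shows "Y *v v = 0"
proof -
  have "u \<bullet> (Y *v v) = 0" for u
  proof (rule ccontr)
    define a where "a = u \<bullet> (Y *v v)"
    define c where "c = u \<bullet> (Y *v u)"
    assume "u \<bullet> (Y *v v) \<noteq> 0"
    then have a: "a \<noteq> 0" by (simp add: a_def)
    have expand: "(u + t *\<^sub>R v) \<bullet> (Y *v (u + t *\<^sub>R v)) = c + 2 * t * a" for t
      using v inner_matrix_vector_sym[OF sym, of v u]
      by (simp add: matrix_vector_right_distrib matrix_vector_mult_scaleR inner_add_left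
          inner_add_right a_def c_def)
    \<comment> \<open>This \<open>t\<close> makes the right-hand side of \<open>expand\<close> equal
      to \<open>-1\<close>.\<close>
    have "0 \<le> c + 2 * (- (c + 1) / (2 * a)) * a"
      using psd[of "u + (- (c + 1) / (2 * a)) *\<^sub>R v"] expand by simp
    with a show False by (simp add: field_simps)
  qed
  then show ?thesis using inner_eq_zero_iff by blast
qed

text \<open>Once \<open>Y $ None $ None = 1\<close>, this is the residual of the \<open>i\<close>-th
  equation at the point read off row \<open>None\<close> of \<open>Y\<close>.\<close>

lemma matrix_vector_row_vec_None:
  "(Y *v row_vec A b i) $ None = Y $ None $ None * b $ i - (A *v (\<chi> j. Y $ None $ Some j)) $ i"
  by (simp add: matrix_vector_mult_def row_vec_def UNIV_option_conv sum.reindex sum_negf mult_ac)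

theorem corollary3p1:
  fixes Q :: "real^'n^'n" and c :: "real^'n" and A :: "real^'n^'m" and b :: "real^'m"
    and K :: "(real^('n option)^('n option)) set"
  assumes "Q \<in> sym_mats"
    and "infeasible (QP Q c A b)"
    and "K \<in> cone_family"
  shows "infeasible (conic_problem Q c A b K)"
proof (rule ccontr)
  assume "\<not> infeasible (conic_problem Q c A b K)"
  then obtain Y where Y: "Y \<in> K" "A_hat A b \<bullet> Y = 0" "Y $ None $ None = 1"
    by (auto simp: infeasible_def conic_problem_def)
  have "Y \<in> psd0" using Y(1) assms(3) by (auto simp: cone_family_def)
  then have sym: "Y \<in> sym_mats" and psd: "\<And>v. 0 \<le> v \<bullet> (Y *v v)"
    and nonneg: "\<And>j. 0 \<le> Y $ None $ Some j"
    by (auto simp: psd0_def)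
  define x :: "real^'n" where "x = (\<chi> j. Y $ None $ Some j)"
  have "(\<Sum>i\<in>UNIV. row_vec A b i \<bullet> (Y *v row_vec A b i)) = 0"
    using Y(2) by (simp add: A_hat_eq_sum_outer inner_sum_left outer_inner)
  then have "row_vec A b i \<bullet> (Y *v row_vec A b i) = 0" for i
    using psd by (simp add: sum_nonneg_eq_0_iff)
  then have "(Y *v row_vec A b i) $ None = 0" for i
    by (metis psd_isotropic_imp_kernel[OF sym psd] zero_index)
  then have "A *v x = b"
    using Y(3) by (simp add: matrix_vector_row_vec_None vec_eq_iff x_def)
  moreover have "0 \<le> x" using nonneg by (simp add: x_def less_eq_vec_def)
  ultimately show False using assms(2) by (auto simp: infeasible_def QP_def)
qed

end
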